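(* Let $d\in\mathbb{N}$ and let $\mathcal{F}$ be a collection of axis-parallel boxes in $\mathbb{R}^d$ such that $\mathcal{F}$ cannot be pierced by any finite number of axis-parallel hyperplanes (i.e. for no finite family $\mathcal{H}$ of axis-parallel hyperplanes does every box of $\mathcal{F}$ intersect some member of $\mathcal{H}$). Then $\mathcal{F}$ contains an infinite sequence $\{B_n\}_{n\in\mathbb{N}}$ of boxes such that no axis-parallel hyperplane intersects two boxes $B_i,B_j$ with $i\neq j$.
   Context: An axis-parallel box in $\mathbb{R}^d$ is a set $[a_1,b_1]\times\cdots\times[a_d,b_d]$ with $a_i\le b_i$ real for all $i$. An axis-parallel hyperplane in $\mathbb{R}^d$ is a set $\{x\in\mathbb{R}^d : x_i=c\}$ for some $i\in\{1,\dots,d\}$ and $c\in\mathbb{R}$. *)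

theory Defs
  imports "HOL-Analysis.Analysis"
begin

definition axis_parallel_box :: "(real ^ 'n) set \<Rightarrow> bool" where
  "axis_parallel_box B \<longleftrightarrow> (\<exists>a b. (\<forall>i. a $ i \<le> b $ i) \<and> B = cbox a b)"

definition axis_parallel_hyperplane :: "(real ^ 'n) set \<Rightarrow> bool" where
  "axis_parallel_hyperplane h \<longleftrightarrow> (\<exists>i c. h = {x. x $ i = c})"

definition pierces :: "'a set set \<Rightarrow> 'a set set \<Rightarrow> bool" where
  "pierces H F \<longleftrightarrow> (\<forall>B\<in>F. \<exists>h\<in>H. B \<inter> h \<noteq> {})"

end

theory Submission
  imports Defs
begin

text \<open>
  Finitely pierceable families form an ideal. Compactify each coordinate axis by
  \<^term>\<open>arctan\<close>; by compactness, the pairs of corners of the boxes accumulate, modulo this ideal,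
  at some pair \<open>(p, q)\<close>. If \<open>p\<close> and \<open>q\<close> differed in a coordinate, one hyperplane strictly between
  them would pierce all boxes with corners near \<open>(p, q)\<close>; so \<open>p = q\<close>. Thus arbitrarily close to \<open>p\<close>
  there are boxes that miss every axis-parallel hyperplane through \<open>p\<close>, and choosing each box much
  closer to \<open>p\<close> than all the previous ones gives the sequence.
\<close>

definition finitely_pierced :: "(real ^ 'n) set set \<Rightarrow> bool" where
  "finitely_pierced F \<longleftrightarrow>
    (\<exists>H. finite H \<and> (\<forall>h\<in>H. axis_parallel_hyperplane h) \<and> pierces H F)"

lemma finitely_pierced_UN:
  assumes "finite I" and "\<And>i. i \<in> I \<Longrightarrow> finitely_pierced (G i)"
  shows "finitely_pierced (\<Union>i\<in>I. G i)"
proof -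
  obtain H where H: "\<And>i. i \<in> I \<Longrightarrow> finite (H i) \<and> (\<forall>h\<in>H i. axis_parallel_hyperplane h) \<and> pierces (H i) (G i)"
    using assms(2) unfolding finitely_pierced_def by metis
  show ?thesis
    unfolding finitely_pierced_def
  proof (intro exI conjI)
    show "finite (\<Union>i\<in>I. H i)" using assms(1) H by blast
    show "\<forall>h\<in>\<Union>i\<in>I. H i. axis_parallel_hyperplane h" using H by blast
    show "pierces (\<Union>i\<in>I. H i) (\<Union>i\<in>I. G i)" using H unfolding pierces_def by blast
  qed
qed

lemma finitely_pierced_mono:
  "finitely_pierced G \<Longrightarrow> F \<subseteq> G \<Longrightarrow> finitely_pierced F"
  unfolding finitely_pierced_def pierces_def by (meson subsetD)

lemma finitely_pierced_by_coordinate: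
  assumes "\<And>B. B \<in> F \<Longrightarrow> \<exists>x\<in>B. x $ i = c"
  shows "finitely_pierced F"
  unfolding finitely_pierced_def
proof (intro exI conjI)
  show "\<forall>h\<in>{{x. x $ i = c}}. axis_parallel_hyperplane h"
    unfolding axis_parallel_hyperplane_def by blast
  show "pierces {{x. x $ i = c}} F" using assms by (fastforce simp: pierces_def)
qed simp

text \<open>Otherwise every point has a ball whose preimage in \<open>F\<close> is finitely pierced.
  Finitely many of these balls cover \<open>K\<close>, and their piercing families together pierce
  \<open>F\<close>.\<close>

lemma not_finitely_pierced_accumulation:
  fixes f :: "(real ^ 'n) set \<Rightarrow> 'a::metric_space"
  assumes F: "\<not> finitely_pierced F" and K: "compact K" and fK: "f ` F \<subseteq> K"
  obtains p where "\<And>\<epsilon>. \<epsilon> > 0 \<Longrightarrow> \<not> finitely_pierced {B \<in> F. dist (f B) p < \<epsilon>}"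
proof (rule ccontr)
  assume "\<not> thesis"
  then have "\<forall>p. \<exists>\<epsilon>>0. finitely_pierced {B \<in> F. dist (f B) p < \<epsilon>}" using that by blast
  then obtain e where e: "\<And>p. e p > 0" "\<And>p. finitely_pierced {B \<in> F. dist (f B) p < e p}"
    by metis
  have "K \<subseteq> (\<Union>p\<in>K. ball p (e p))" using e(1) by auto
  then obtain C where C: "C \<subseteq> K" "finite C" "K \<subseteq> (\<Union>p\<in>C. ball p (e p))"
    using compactE_image[OF K, of K "\<lambda>p. ball p (e p)"] by auto
  have "finitely_pierced (\<Union>p\<in>C. {B \<in> F. dist (f B) p < e p})"
    using C(2) e(2) by (intro finitely_pierced_UN)
  moreover have "F \<subseteq> (\<Union>p\<in>C. {B \<in> F. dist (f B) p < e p})"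
    using C(3) fK by (fastforce simp: dist_commute)
  ultimately show False using F finitely_pierced_mono by blast
qed

lemma cbox_vec_slice_nonempty:
  fixes a b :: "real ^ 'n"
  assumes "\<forall>i. a $ i \<le> b $ i" and "a $ i \<le> c" and "c \<le> b $ i"
  shows "\<exists>x\<in>cbox a b. x $ i = c"
proof
  show "(\<chi> j. if j = i then c else a $ j) \<in> cbox a b"
    using assms by (simp add: mem_box_cart)
qed simp

text \<open>The point \<open>p\<close> lives in arctan coordinates, so that entries
  \<plusminus>\<pi>/2 are available for boxes escaping to infinity. The bound \<epsilon> places a
  box close to \<open>p\<close>; the gap \<delta> leaves room for later boxes to be closer still in
  every coordinate.\<close>

lemma boxes_shrinking_to_point:
  fixes F :: "(real ^ 'n) set set"
  assumes boxes: "\<forall>B\<in>F. axis_parallel_box B" and F: "\<not> finitely_pierced F"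
  obtains p :: "real ^ 'n" where
    "\<And>\<epsilon>. \<epsilon> > 0 \<Longrightarrow> \<exists>B\<in>F. \<exists>\<delta>>0. \<forall>x\<in>B. \<forall>i.
       \<bar>arctan (x $ i) - p $ i\<bar> < \<epsilon> \<and> \<delta> \<le> \<bar>arctan (x $ i) - p $ i\<bar>"
proof -
  obtain a b where ab: "\<And>B i. B \<in> F \<Longrightarrow> a B $ i \<le> b B $ i" "\<And>B. B \<in> F \<Longrightarrow> B = cbox (a B) (b B)"
    using boxes unfolding axis_parallel_box_def by metis
  define ac :: "real ^ 'n \<Rightarrow> real ^ 'n" where "ac x = (\<chi> i. arctan (x $ i))" for x
  \<comment> \<open>The closed cube adds, for compactness, the values \<plusminus>\<pi>/2 that
    \<open>arctan\<close> never attains.\<close>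
  define K :: "(real ^ 'n) set" where "K = cbox (\<chi> i. - pi/2) (\<chi> i. pi/2)"
  have ac_K: "ac x \<in> K" for x
    using arctan_lbound arctan_ubound by (auto simp: K_def ac_def mem_box_cart less_imp_le)
  have "compact (K \<times> K)" unfolding K_def by (intro compact_Times compact_cbox)
  moreover have "(\<lambda>B. (ac (a B), ac (b B))) ` F \<subseteq> K \<times> K" using ac_K by auto
  ultimately obtain pq where
    pq: "\<And>\<epsilon>. \<epsilon> > 0 \<Longrightarrow> \<not> finitely_pierced {B \<in> F. dist (ac (a B), ac (b B)) pq < \<epsilon>}"
    using not_finitely_pierced_accumulation[OF F, where f = "\<lambda>B. (ac (a B), ac (b B))"] by blast
  obtain p q where pq_eq: "pq = (p, q)" by fastforce
  define near where
    "near \<epsilon> = {B \<in> F. \<forall>i. \<bar>arctan (a B $ i) - p $ i\<bar> < \<epsilon> \<and> \<bar>arctan (b B $ i) - q $ i\<bar> < \<epsilon>}" for \<epsilon>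
  have near: "\<not> finitely_pierced (near \<epsilon>)" if "\<epsilon> > 0" for \<epsilon>
  proof
    have "\<bar>arctan (u $ i) - p $ i\<bar> < \<epsilon> \<and> \<bar>arctan (v $ i) - q $ i\<bar> < \<epsilon>"
      if "dist (ac u, ac v) pq < \<epsilon>" for u v i
    proof -
      have "dist (ac u) p < \<epsilon>" "dist (ac v) q < \<epsilon>"
        using that dist_fst_le[of "(ac u, ac v)" pq] dist_snd_le[of "(ac u, ac v)" pq]
        by (auto simp: pq_eq)
      then show ?thesis
        using dist_vec_nth_le[of "ac u" i p] dist_vec_nth_le[of "ac v" i q]
        by (auto simp: ac_def dist_real_def)
    qed
    then have "{B \<in> F. dist (ac (a B), ac (b B)) pq < \<epsilon>} \<subseteq> near \<epsilon>" by (auto simp: near_def)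
    moreover assume "finitely_pierced (near \<epsilon>)"
    ultimately show False using pq[OF that] finitely_pierced_mono by blast
  qed
  have "p $ i = q $ i" for i
  proof (rule ccontr)
    assume neq: "p $ i \<noteq> q $ i"
    \<comment> \<open>Half the gap, with \<open>c\<close> the midpoint. If
      \<open>p $ i < q $ i\<close>, corners within \<epsilon> of their limits straddle
      \<open>c\<close>; if \<open>p $ i > q $ i\<close>, the lower corner would exceed the upper
      one, so no such box exists.\<close>
    define \<epsilon> where "\<epsilon> = \<bar>p $ i - q $ i\<bar> / 2"
    have "\<epsilon> > 0" using neq by (simp add: \<epsilon>_def)
    define c where "c = (p $ i + q $ i) / 2"
    have "\<exists>x\<in>B. x $ i = tan c" if B: "B \<in> near \<epsilon>" for B
    proof -
      have BF: "B \<in> F" and n: "\<bar>arctan (a B $ i) - p $ i\<bar> < \<epsilon>" "\<bar>arctan (b B $ i) - q $ i\<bar> < \<epsilon>"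
        using B by (auto simp: near_def)
      have "arctan (a B $ i) \<le> arctan (b B $ i)" using ab(1)[OF BF] by (simp add: arctan_le_iff)
      then have c: "arctan (a B $ i) \<le> c" "c \<le> arctan (b B $ i)"
        using n unfolding \<epsilon>_def c_def by (auto simp: abs_if field_simps split: if_splits)
      \<comment> \<open>Lying between two values of \<open>arctan\<close>, \<open>c\<close> is in
        its open range, so the hyperplane at \<open>tan c\<close> really corresponds to
        \<open>c\<close>.\<close>
      have "- (pi/2) < c" "c < pi/2"
        using c arctan_lbound[of "a B $ i"] arctan_ubound[of "b B $ i"] by linarith+
      then have "arctan (tan c) = c" by (simp add: arctan_tan)
      then have "a B $ i \<le> tan c" "tan c \<le> b B $ i" using c by (metis arctan_le_iff)+
      then have "\<exists>x\<in>cbox (a B) (b B). x $ i = tan c"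
        using ab(1)[OF BF] by (intro cbox_vec_slice_nonempty) auto
      then show ?thesis using ab(2)[OF BF] by simp
    qed
    then show False using finitely_pierced_by_coordinate near[OF \<open>\<epsilon> > 0\<close>] by blast
  qed
  then have q: "q = p" by (simp add: vec_eq_iff)
  have "\<exists>B\<in>F. \<exists>\<delta>>0. \<forall>x\<in>B. \<forall>i.
      \<bar>arctan (x $ i) - p $ i\<bar> < \<epsilon> \<and> \<delta> \<le> \<bar>arctan (x $ i) - p $ i\<bar>" if "\<epsilon> > 0" for \<epsilon>
  proof -
    \<comment> \<open>If \<open>p $ i = \<plusminus>\<pi>/2\<close> then \<open>tan (p $ i)\<close> is a junk value, but avoiding one more hyperplane is harmless.\<close>
    have "\<exists>B\<in>near \<epsilon>. \<forall>i. \<forall>x\<in>B. x $ i \<noteq> tan (p $ i)"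
    proof (rule ccontr)
      assume "\<not> ?thesis"
      \<comment> \<open>One hyperplane for each of the finitely many coordinates would then
        suffice.\<close>
      then have "near \<epsilon> \<subseteq> (\<Union>i\<in>UNIV. {B. \<exists>x\<in>B. x $ i = tan (p $ i)})" by blast
      moreover have "finitely_pierced (\<Union>i\<in>UNIV. {B. \<exists>x\<in>B. x $ i = tan (p $ i)})"
        by (rule finitely_pierced_UN) (auto intro: finitely_pierced_by_coordinate)
      ultimately show False using near[OF that] finitely_pierced_mono by blast
    qed
    then obtain B where B: "B \<in> near \<epsilon>" and avoid: "\<And>i x. x \<in> B \<Longrightarrow> x $ i \<noteq> tan (p $ i)" by blast
    have BF: "B \<in> F" using B by (simp add: near_def)
    \<comment> \<open>The arctan image of each side of \<open>B\<close> will be shown to miss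
      \<open>p $ i\<close>, so its distance from \<open>p $ i\<close> is attained at an endpoint.
      The minimum over the finitely many coordinates is a uniform gap.\<close>
    define D where "D i = min \<bar>arctan (a B $ i) - p $ i\<bar> \<bar>arctan (b B $ i) - p $ i\<bar>" for i
    define \<delta> where "\<delta> = Min (range D)"
    have in_B: "a B \<in> B" "b B \<in> B"
      using ab(1)[OF BF] ab(2)[OF BF] by (metis mem_box_cart(2) order_refl)+
    have off: "arctan (x $ i) \<noteq> p $ i" if "x \<in> B" for x i
      using avoid[OF that] by (metis tan_arctan)
    have "\<delta> > 0" using off in_B by (auto simp: \<delta>_def D_def)
    moreover have "\<bar>arctan (x $ i) - p $ i\<bar> < \<epsilon> \<and> \<delta> \<le> \<bar>arctan (x $ i) - p $ i\<bar>" if x: "x \<in> B" for x i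
    proof -
      have "a B $ i \<le> x $ i" "x $ i \<le> b B $ i"
        using x ab(2)[OF BF] by (metis mem_box_cart(2))+
      then have le: "arctan (a B $ i) \<le> arctan (x $ i)" "arctan (x $ i) \<le> arctan (b B $ i)"
        by (simp_all add: arctan_le_iff)
      have n: "\<bar>arctan (a B $ i) - p $ i\<bar> < \<epsilon>" "\<bar>arctan (b B $ i) - p $ i\<bar> < \<epsilon>"
        using B by (auto simp: near_def q)
      \<comment> \<open>A side straddling \<open>p $ i\<close> would force \<open>p $ i\<close> into
        the open range of \<open>arctan\<close>; then \<open>B\<close> would meet the avoided
        hyperplane at \<open>tan (p $ i)\<close>.\<close>
      have "\<not> (arctan (a B $ i) \<le> p $ i \<and> p $ i \<le> arctan (b B $ i))"
      proof
        assume c: "arctan (a B $ i) \<le> p $ i \<and> p $ i \<le> arctan (b B $ i)"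
        have "- (pi/2) < p $ i" "p $ i < pi/2"
          using c arctan_lbound[of "a B $ i"] arctan_ubound[of "b B $ i"] by linarith+
        then have "arctan (tan (p $ i)) = p $ i" by (simp add: arctan_tan)
        then have "a B $ i \<le> tan (p $ i)" "tan (p $ i) \<le> b B $ i" using c by (metis arctan_le_iff)+
        then have "\<exists>x\<in>cbox (a B) (b B). x $ i = tan (p $ i)"
          using ab(1)[OF BF] by (intro cbox_vec_slice_nonempty) auto
        then show False using avoid ab(2)[OF BF] by metis
      qed
      then have "D i \<le> \<bar>arctan (x $ i) - p $ i\<bar>" using le unfolding D_def by linarith
      moreover have "\<delta> \<le> D i" unfolding \<delta>_def by simp
      ultimately show ?thesis using le n by linarith
    qed
    ultimately show ?thesis using BF by blast
  qed
  then show thesis using that by blast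
qed

theorem theorem11:
  fixes F :: "(real ^ 'n) set set"
  assumes boxes: "\<forall>B\<in>F. axis_parallel_box B"
    and not_pierced:
      "\<not> (\<exists>H. finite H \<and> (\<forall>h\<in>H. axis_parallel_hyperplane h) \<and> pierces H F)"
  shows "\<exists>B :: nat \<Rightarrow> (real ^ 'n) set. (\<forall>n. B n \<in> F) \<and>
    (\<forall>h. axis_parallel_hyperplane h \<longrightarrow>
      \<not> (\<exists>i j. i \<noteq> j \<and> h \<inter> B i \<noteq> {} \<and> h \<inter> B j \<noteq> {}))"
proof -
  obtain p :: "real ^ 'n" where p:
    "\<And>\<epsilon>. \<epsilon> > 0 \<Longrightarrow> \<exists>B\<in>F. \<exists>\<delta>>0. \<forall>x\<in>B. \<forall>i.
       \<bar>arctan (x $ i) - p $ i\<bar> < \<epsilon> \<and> \<delta> \<le> \<bar>arctan (x $ i) - p $ i\<bar>"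
    using boxes_shrinking_to_point[OF boxes] not_pierced unfolding finitely_pierced_def by metis
  \<comment> \<open>Together, \<open>outside\<close> and \<open>inside\<close> confine every
    coordinate of a box to a shell around that of \<open>p\<close>; boxes in disjoint shells share
    no coordinate value.\<close>
  define outside where "outside B \<delta> \<longleftrightarrow> (\<forall>x\<in>B. \<forall>i. \<delta> \<le> \<bar>arctan (x $ i) - p $ i\<bar>)" for B \<delta>
  define inside where "inside B \<epsilon> \<longleftrightarrow> (\<forall>x\<in>B. \<forall>i. \<bar>arctan (x $ i) - p $ i\<bar> < \<epsilon>)" for B \<epsilon>
  have step: "\<exists>B \<delta>. B \<in> F \<and> 0 < \<delta> \<and> \<delta> \<le> \<epsilon> \<and> outside B \<delta> \<and> inside B \<epsilon>" if "\<epsilon> > 0" for \<epsilon>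
  proof -
    obtain B \<delta> where "B \<in> F" "\<delta> > 0" "outside B \<delta>" "inside B \<epsilon>"
      using p[OF \<open>\<epsilon> > 0\<close>] unfolding outside_def inside_def by blast
    \<comment> \<open>Capping \<delta> at \<epsilon> preserves \<open>outside\<close> and will make
      the inner radii non-increasing along the sequence.\<close>
    then have "B \<in> F \<and> 0 < min \<delta> \<epsilon> \<and> min \<delta> \<epsilon> \<le> \<epsilon> \<and> outside B (min \<delta> \<epsilon>) \<and> inside B \<epsilon>"
      using that by (auto simp: outside_def min.coboundedI1)
    then show ?thesis by blast
  qed
  \<comment> \<open>Each state pairs a box with its inner radius, which serves as the outer radius
    of the next box.\<close>
  have "\<exists>s. \<forall>n. (fst (s n) \<in> F \<and> 0 < snd (s n) \<and> outside (fst (s n)) (snd (s n))) \<and>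
      (snd (s (Suc n)) \<le> snd (s n) \<and> inside (fst (s (Suc n))) (snd (s n)))"
  proof (rule dependent_nat_choice)
    show "\<exists>s. fst s \<in> F \<and> 0 < snd s \<and> outside (fst s) (snd s)"
      using step[of 1] by fastforce
  next
    fix s :: "(real ^ 'n) set \<times> real" and n :: nat
    assume "fst s \<in> F \<and> 0 < snd s \<and> outside (fst s) (snd s)"
    then show "\<exists>t. (fst t \<in> F \<and> 0 < snd t \<and> outside (fst t) (snd t)) \<and>
        (snd t \<le> snd s \<and> inside (fst t) (snd s))"
      using step[of "snd s"] by fastforce
  qed
  then obtain s where s: "\<And>n. fst (s n) \<in> F" "\<And>n. outside (fst (s n)) (snd (s n))"
    "\<And>n. snd (s (Suc n)) \<le> snd (s n)" "\<And>n. inside (fst (s (Suc n))) (snd (s n))"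
    by blast
  have separated: "x $ k \<noteq> y $ k" if "i < j" "x \<in> fst (s i)" "y \<in> fst (s j)" for i j k x y
  proof -
    \<comment> \<open>The outer radius of box \<open>j\<close> is the inner radius of its
      predecessor \<open>m\<close>, which is at most that of box \<open>i\<close>.\<close>
    obtain m where m: "j = Suc m" "i \<le> m" using \<open>i < j\<close> by (cases j) auto
    have "snd (s m) \<le> snd (s i)" using lift_Suc_antimono_le[of "\<lambda>n. snd (s n)"] s(3) m(2) by blast
    moreover have "\<bar>arctan (y $ k) - p $ k\<bar> < snd (s m)"
      using s(4) that(3) unfolding inside_def m(1) by blast
    moreover have "snd (s i) \<le> \<bar>arctan (x $ k) - p $ k\<bar>"
      using s(2) that(2) unfolding outside_def by blast
    ultimately show ?thesis by auto
  qed
  \<comment> \<open>Points of two boxes on one hyperplane agree in its fixed coordinate, which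
    \<open>separated\<close> excludes for either order of the indices.\<close>
  have "\<not> (h \<inter> fst (s i) \<noteq> {} \<and> h \<inter> fst (s j) \<noteq> {})"
    if h: "axis_parallel_hyperplane h" and "i \<noteq> j" for h i j
  proof -
    obtain k c where "h = {x. x $ k = c}" using h unfolding axis_parallel_hyperplane_def by blast
    then show ?thesis using separated[of i j _ _ k] separated[of j i _ _ k] \<open>i \<noteq> j\<close>
      by (cases "i < j") fastforce+
  qed
  then show ?thesis using s(1) by (intro exI[of _ "\<lambda>n. fst (s n)"]) blast
qed

end
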